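(* Let $n\ge 8$ be an integer and define $p(n)=2n-1-\lfloor n/4\rfloor$ if $n\equiv 0$ or $3 \pmod 4$, and $p(n)=2n-\lfloor n/4\rfloor$ otherwise. Then the minimum number of edges of a connected locally nonforesty graph of order $n$ is $p(n)$; that is, every connected locally nonforesty graph of order $n$ has at least $p(n)$ edges, and there exists a connected locally nonforesty graph of order $n$ with exactly $p(n)$ edges.
   Context: All graphs are finite and simple. The order of a graph is its number of vertices and its size is its number of edges. For a vertex $v$ of a graph $G$, the local subgraph at $v$ is the subgraph of $G$ induced by the (open) neighborhood $N(v)$ of $v$. A graph $G$ is called locally nonforesty if every local subgraph of $G$ contains a cycle (equivalently, every vertex of $G$ is the hub of a wheel in $G$). *)

theory Defs
  imports Main
begin

text \<open>
  A graph is given by a vertex set \<open>V\<close> and a set \<open>E\<close> of edges, each edge being a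
  two-element set of vertices. Its order is \<open>card V\<close>, its size is \<open>card E\<close>.
\<close>

definition simple_graph :: "'a set \<Rightarrow> 'a set set \<Rightarrow> bool" where
  "simple_graph V E \<longleftrightarrow> finite V \<and> (\<forall>e\<in>E. e \<subseteq> V \<and> card e = 2)"

definition connected_graph :: "'a set \<Rightarrow> 'a set set \<Rightarrow> bool" where
  "connected_graph V E \<longleftrightarrow> V \<noteq> {} \<and> (\<forall>u\<in>V. \<forall>v\<in>V. (u, v) \<in> {(x, y). {x, y} \<in> E}\<^sup>*)"

definition neighborhood :: "'a set set \<Rightarrow> 'a \<Rightarrow> 'a set" where
  "neighborhood E v = {u. {v, u} \<in> E}"

definition induced_edges :: "'a set set \<Rightarrow> 'a set \<Rightarrow> 'a set set" where
  "induced_edges E S = {e \<in> E. e \<subseteq> S}"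

text \<open>A cycle is listed as its vertices in cyclic order, without repeating the first one.\<close>

definition is_cycle :: "'a set \<Rightarrow> 'a set set \<Rightarrow> 'a list \<Rightarrow> bool" where
  "is_cycle V E c \<longleftrightarrow> 3 \<le> length c \<and> distinct c \<and> set c \<subseteq> V \<and>
     (\<forall>i < length c. {c ! i, c ! (Suc i mod length c)} \<in> E)"

definition contains_cycle :: "'a set \<Rightarrow> 'a set set \<Rightarrow> bool" where
  "contains_cycle V E \<longleftrightarrow> (\<exists>c. is_cycle V E c)"

definition locally_nonforesty :: "'a set \<Rightarrow> 'a set set \<Rightarrow> bool" where
  "locally_nonforesty V E \<longleftrightarrow>
     (\<forall>v\<in>V. contains_cycle (neighborhood E v) (induced_edges E (neighborhood E v)))"

definition p :: "nat \<Rightarrow> nat" where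
  "p n = (if n mod 4 = 0 \<or> n mod 4 = 3 then 2 * n - 1 - n div 4 else 2 * n - n div 4)"

end

theory Submission
  imports Defs
begin

text \<open>
  For a vertex set \<open>S\<close> put \<open>f(S) = 4 e(S) - 7 |S| + 4\<close>, where \<open>e(S)\<close> counts the edges inside
  \<open>S\<close>. Grow \<open>S\<close> from a single wheel, of rim length \<open>l\<close> and hence with \<open>f(S) \<ge> l - 3\<close>, by
  repeatedly adding a wheel whose hub is a neighbour of \<open>S\<close>. If the wheel meets \<open>S\<close>, then
  \<open>f\<close> grows by at least 3. If it is disjoint from \<open>S\<close> and has a rim of length \<open>l\<close>, its
  \<open>2 l\<close> edges and the edge joining the hub to \<open>S\<close> make \<open>f\<close> grow by
  at least \<open>l - 3\<close>; for \<open>l \<ge> 4\<close> a rim vertex is not yet the hub of a wheel, so it either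
  forces an additional edge or lets one absorb a second, overlapping wheel, and again \<open>f\<close>
  grows by at least 3. Hence in the end \<open>f(V) \<ge> 3\<close>, or only copies of \<open>K\<^sub>4\<close> were added,
  so that 4 divides \<open>|V|\<close> and \<open>f(V) \<ge> 0\<close>.

  Extremal graphs are chains of copies of \<open>K\<^sub>4\<close>, consecutive ones being joined by an edge,
  sharing a vertex, or (once) sharing a triangle.
\<close>

section \<open>Wheels and the edges of their rims\<close>

definition rim :: "'a list \<Rightarrow> 'a set set" where
  "rim c = (\<lambda>i. {c ! i, c ! (Suc i mod length c)}) ` {..<length c}"

definition spokes :: "'a \<Rightarrow> 'a list \<Rightarrow> 'a set set" where
  "spokes v c = (\<lambda>x. {v, x}) ` set c"

definition is_wheel :: "'a set set \<Rightarrow> 'a \<Rightarrow> 'a list \<Rightarrow> bool" where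
  "is_wheel E v c \<longleftrightarrow> 3 \<le> length c \<and> distinct c \<and> rim c \<subseteq> E \<and> spokes v c \<subseteq> E"

text \<open>Two different positions giving the same edge would each be the cyclic successor of the
  other, which is impossible on a cycle of length at least 3. Hence rim edges can be counted by
  positions.\<close>

lemma inj_on_rim:
  assumes "distinct c" and "3 \<le> length c"
  shows "inj_on (\<lambda>i. {c ! i, c ! (Suc i mod length c)}) {..<length c}"
proof (rule inj_onI)
  fix i j
  assume ij: "i \<in> {..<length c}" "j \<in> {..<length c}"
    and eq: "{c ! i, c ! (Suc i mod length c)} = {c ! j, c ! (Suc j mod length c)}"
  let ?l = "length c"
  have lt: "Suc i mod ?l < ?l" "Suc j mod ?l < ?l"
    using assms(2) by (auto intro!: mod_less_divisor)
  show "i = j"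
  proof (rule ccontr)
    assume "i \<noteq> j"
    then have "c ! i = c ! (Suc j mod ?l)" "c ! (Suc i mod ?l) = c ! j"
      using eq ij assms(1) by (auto simp: doubleton_eq_iff nth_eq_iff_index_eq)
    then have "i = Suc j mod ?l" "j = Suc i mod ?l"
      using ij lt assms(1) by (auto simp: nth_eq_iff_index_eq)
    moreover have "Suc k mod ?l = (if Suc k = ?l then 0 else Suc k)" if "k < ?l" for k
      using that by auto
    ultimately show False
      using ij assms(2) by (auto split: if_splits)
  qed
qed

text \<open>Each rim vertex outside \<open>S\<close> is the first end of a rim edge that is not
  inside \<open>S\<close> (positions \<open>I\<close>). If the rim has vertices on both sides, some
  edge leads from \<open>S\<close> to a vertex outside, and its position lies in \<open>J\<close>
  but not in \<open>I\<close>: this is the additional 1.\<close>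

lemma card_rim_outside:
  assumes c: "distinct c" "3 \<le> length c"
  shows "card (set c - S) + (if 0 < card (set c - S) \<and> card (set c - S) < length c then 1 else 0)
    \<le> card {e \<in> rim c. \<not> e \<subseteq> S}"
proof -
  let ?l = "length c"
  let ?e = "\<lambda>i. {c ! i, c ! (Suc i mod ?l)}"
  define I where "I = {i. i < ?l \<and> c ! i \<notin> S}"
  define J where "J = {i. i < ?l \<and> c ! (Suc i mod ?l) \<notin> S}"
  have fin: "finite I" "finite J" by (auto simp: I_def J_def)
  have "set c - S = (!) c ` I"
    by (auto simp: I_def in_set_conv_nth)
  moreover have "inj_on ((!) c) I"
    using c(1) by (auto simp: inj_on_def I_def nth_eq_iff_index_eq)
  ultimately have cI: "card (set c - S) = card I" by (simp add: card_image)
  have "{e \<in> rim c. \<not> e \<subseteq> S} = ?e ` (I \<union> J)"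
    by (auto simp: rim_def I_def J_def)
  moreover have "inj_on ?e (I \<union> J)"
    by (rule inj_on_subset[OF inj_on_rim[OF c]]) (auto simp: I_def J_def)
  ultimately have cIJ: "card {e \<in> rim c. \<not> e \<subseteq> S} = card (I \<union> J)"
    by (simp add: card_image)
  have "card I + 1 \<le> card (I \<union> J)" if "0 < card I" "card I < ?l"
  proof -
    \<comment> \<open>otherwise \<open>S\<close> would be closed under the cyclic successor\<close>
    have "\<not> J \<subseteq> I"
    proof
      assume JI: "J \<subseteq> I"
      have "I \<noteq> {..<?l}" using that(2) by auto
      then obtain j where j: "j < ?l" "c ! j \<in> S" by (auto simp: I_def)
      have step: "c ! (Suc i mod ?l) \<in> S" if "i < ?l" "c ! i \<in> S" for i
        using JI that by (auto simp: I_def J_def)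
      have all: "c ! ((j + k) mod ?l) \<in> S" for k
      proof (induction k)
        case 0
        then show ?case using j by simp
      next
        case (Suc k)
        have "(j + k) mod ?l < ?l" using j(1) by (intro mod_less_divisor) linarith
        from step[OF this Suc] show ?case by (simp add: mod_Suc_eq)
      qed
      have "I \<noteq> {}" using that(1) by auto
      then obtain i where i: "i < ?l" "c ! i \<notin> S" by (auto simp: I_def)
      \<comment> \<open>Going around from position \<open>j\<close>, \<open>?l - j + i\<close> steps
        end at position \<open>i\<close>.\<close>
      have "(j + (?l - j + i)) mod ?l = i" using i j by simp
      with all[of "?l - j + i"] i show False by simp
    qed
    then have "I \<subset> I \<union> J" by auto
    then show ?thesis using psubset_card_mono[of "I \<union> J" I] fin by simp
  qed
  moreover have "card I \<le> card (I \<union> J)" using fin by (intro card_mono) auto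
  ultimately show ?thesis unfolding cI cIJ by auto
qed

section \<open>Wheels in simple and locally nonforesty graphs\<close>

lemma finite_edges:
  assumes "simple_graph V E"
  shows "finite E"
  using assms unfolding simple_graph_def by (intro finite_subset[of E "Pow V"]) auto

lemma edge_in_graph:
  assumes "simple_graph V E" and "{x, y} \<in> E"
  shows "x \<in> V" "y \<in> V" "x \<noteq> y"
proof -
  have "{x, y} \<subseteq> V" "card {x, y} = 2" using assms unfolding simple_graph_def by auto
  then show "x \<in> V" "y \<in> V" "x \<noteq> y" by auto
qed

lemma locally_nonforesty_wheel:
  assumes "locally_nonforesty V E" and "v \<in> V"
  obtains c where "is_wheel E v c"
proof -
  obtain c where c: "is_cycle (neighborhood E v) (induced_edges E (neighborhood E v)) c"
    using assms unfolding locally_nonforesty_def contains_cycle_def by auto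
  then have "is_wheel E v c"
    unfolding is_wheel_def is_cycle_def rim_def spokes_def
    by (auto simp: induced_edges_def neighborhood_def)
  then show ?thesis using that by blast
qed

lemma wheel_hub_notin:
  assumes "simple_graph V E" and "is_wheel E v c"
  shows "v \<notin> set c"
  using assms edge_in_graph(3)[OF assms(1)] unfolding is_wheel_def spokes_def by blast

lemma wheel_subset:
  assumes "simple_graph V E" and "is_wheel E v c"
  shows "insert v (set c) \<subseteq> V"
proof -
  have "c \<noteq> []" and sp: "\<And>x. x \<in> set c \<Longrightarrow> {v, x} \<in> E"
    using assms(2) unfolding is_wheel_def spokes_def by auto
  then have "hd c \<in> set c" by simp
  then show ?thesis using sp edge_in_graph[OF assms(1)] by blast
qed

section \<open>Growth of \<open>f\<close> when a wheel is added\<close>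

text \<open>Three disjoint families of edges are new: rim edges not inside \<open>S\<close>, spokes
  not inside \<open>S\<close> (all of them if the hub is outside \<open>S\<close>), and
  \<open>X\<close>. The set \<open>X\<close> leaves room for edges that are not part of the wheel,
  such as the edge from the hub to \<open>S\<close>.\<close>

lemma wheel_growth:
  assumes G: "simple_graph V E" and W: "is_wheel E v c"
    and X: "X \<subseteq> induced_edges E (S \<union> insert v (set c))"
      "X \<inter> (induced_edges E S \<union> rim c \<union> spokes v c) = {}"
  shows "card (induced_edges E S) + card X
      + card (set c - S) + (if 0 < card (set c - S) \<and> card (set c - S) < length c then 1 else 0)
      + (if v \<in> S then card (set c - S) else length c)
    \<le> card (induced_edges E (S \<union> insert v (set c)))"
proof -
  let ?T = "S \<union> insert v (set c)"
  let ?R = "{e \<in> rim c. \<not> e \<subseteq> S}"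
  define P where "P = (if v \<in> S then set c - S else set c)"
  have l: "3 \<le> length c" and d: "distinct c" and rE: "rim c \<subseteq> E" and sE: "spokes v c \<subseteq> E"
    using W by (auto simp: is_wheel_def)
  have vc: "v \<notin> set c" using wheel_hub_notin[OF G W] .
  have fin: "finite (induced_edges E A)" for A
    using finite_edges[OF G] by (simp add: induced_edges_def)
  have finX: "finite X" using X(1) fin finite_subset by blast
  have finR: "finite ?R" by (simp add: rim_def)
  have finP: "finite P" by (simp add: P_def)
  have Pc: "P \<subseteq> set c" by (auto simp: P_def)
  have rimc: "e \<subseteq> set c" if e: "e \<in> rim c" for e
  proof -
    obtain i where i: "i < length c" "e = {c ! i, c ! (Suc i mod length c)}"
      using e by (auto simp: rim_def)
    have "Suc i mod length c < length c" using i by (intro mod_less_divisor) linarith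
    then show ?thesis using i by auto
  qed
  let ?Q = "(\<lambda>x. {v, x}) ` P"
  have "inj_on (\<lambda>x. {v, x}) P" by (auto simp: inj_on_def doubleton_eq_iff)
  then have cQ: "card ?Q = card P" by (rule card_image)
  have cP: "card P = (if v \<in> S then card (set c - S) else length c)"
    using d by (simp add: P_def distinct_card)
  have Qs: "?Q \<subseteq> spokes v c" using Pc by (auto simp: spokes_def)
  have QS: "?Q \<inter> induced_edges E S = {}"
    by (auto simp: P_def induced_edges_def split: if_splits)
  have QR: "?Q \<inter> ?R = {}" using rimc vc by blast
  have "?R \<inter> induced_edges E S = {}" by (auto simp: induced_edges_def)
  then have "card (induced_edges E S \<union> ?R) = card (induced_edges E S) + card ?R"
    using fin finR by (intro card_Un_disjoint) auto
  moreover have "card (induced_edges E S \<union> ?R \<union> ?Q) = card (induced_edges E S \<union> ?R) + card ?Q"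
  proof (rule card_Un_disjoint)
    show "(induced_edges E S \<union> ?R) \<inter> ?Q = {}" using QR QS by blast
  qed (use fin finR finP in auto)
  moreover have "card (induced_edges E S \<union> ?R \<union> ?Q \<union> X)
      = card (induced_edges E S \<union> ?R \<union> ?Q) + card X"
  proof (rule card_Un_disjoint)
    show "(induced_edges E S \<union> ?R \<union> ?Q) \<inter> X = {}" using X(2) Qs by blast
  qed (use fin finR finP finX in auto)
  moreover have "card (induced_edges E S \<union> ?R \<union> ?Q \<union> X) \<le> card (induced_edges E ?T)"
  proof (rule card_mono[OF fin])
    have "induced_edges E S \<subseteq> induced_edges E ?T" by (auto simp: induced_edges_def)
    moreover have "?R \<subseteq> induced_edges E ?T" using rE rimc by (auto simp: induced_edges_def)
    moreover have "?Q \<subseteq> induced_edges E ?T"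
      using Qs sE Pc by (auto simp: induced_edges_def)
    ultimately show "induced_edges E S \<union> ?R \<union> ?Q \<union> X \<subseteq> induced_edges E ?T" using X(1) by blast
  qed
  ultimately show ?thesis using card_rim_outside[OF d l, of S] cQ cP by linarith
qed

lemma card_wheel_union:
  assumes "simple_graph V E" and "is_wheel E v c" and "finite S"
  shows "card (S \<union> insert v (set c)) = card S + card (set c - S) + (if v \<in> S then 0 else 1)"
proof -
  have v: "v \<notin> set c" using wheel_hub_notin[OF assms(1,2)] .
  have "S \<union> insert v (set c) = S \<union> (set c - S) \<union> ({v} - S)" by auto
  also have "card \<dots> = card (S \<union> (set c - S)) + card ({v} - S)"
    using v assms(3) by (intro card_Un_disjoint) auto
  also have "card (S \<union> (set c - S)) = card S + card (set c - S)"
    using assms(3) by (intro card_Un_disjoint) auto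
  finally show ?thesis by (simp add: insert_Diff_if)
qed

text \<open>Let \<open>m\<close> of the \<open>l\<close> rim vertices lie outside \<open>S\<close>.
  With the hub in \<open>S\<close>, the gain in \<open>f\<close> is at least \<open>m + 4\<close>
  for \<open>0 < m < l\<close> and at least \<open>l\<close> for \<open>m = l\<close>. With the hub
  outside, \<open>m < l\<close>, and the gain is at least \<open>4 * l - 7\<close> for
  \<open>m = 0\<close> and \<open>4 * l - 3 * m - 3\<close> otherwise, which is at least
  \<open>l\<close>.\<close>

lemma meeting_wheel_gain:
  assumes G: "simple_graph V E" and W: "is_wheel E v c" and S: "finite S"
    and meets: "v \<in> S \<or> set c \<inter> S \<noteq> {}" and out: "\<not> insert v (set c) \<subseteq> S"
  defines "T \<equiv> S \<union> insert v (set c)"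
  shows "4 * card (induced_edges E S) + 7 * card T + 3 \<le> 4 * card (induced_edges E T) + 7 * card S"
proof -
  define m where "m = card (set c - S)"
  have l: "3 \<le> length c" and d: "distinct c" using W by (auto simp: is_wheel_def)
  have cl: "card (set c) = length c" using d by (rule distinct_card)
  have ml: "m \<le> length c" using card_mono[of "set c" "set c - S"] cl by (simp add: m_def)
  note g = wheel_growth[OF G W, of "{}" S, folded T_def m_def, simplified]
  note t = card_wheel_union[OF G W S, folded T_def m_def]
  show ?thesis
  proof (cases "v \<in> S")
    case True
    then have "set c - S \<noteq> {}" using out by auto
    then have "0 < m" by (simp add: m_def card_gt_0_iff)
    then show ?thesis using g t True l ml by (cases "m = length c") simp_all
  next
    case False
    then have "set c - S \<subset> set c" using meets by auto
    then have "m < length c"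
      using psubset_card_mono[of "set c" "set c - S"] cl by (simp add: m_def)
    then show ?thesis using g t False l by (cases "m = 0") simp_all
  qed
qed

text \<open>Here \<open>F\<close> holds edges from the hub to \<open>S\<close>: none for the initial
  wheel, one later. The first alternative says that \<open>f\<close> grows by at least
  \<open>4 * card F - 1\<close>. The second is the case of a triangular rim, where growth is only
  guaranteed to be \<open>4 * card F - 4\<close> but exactly 4 vertices are added.\<close>

lemma disjoint_wheel_gain:
  assumes G: "simple_graph V E" and L: "locally_nonforesty V E"
    and W: "is_wheel E v c" and S: "S \<subseteq> V"
    and disj: "insert v (set c) \<inter> S = {}"
    and F: "F \<subseteq> E" "F \<subseteq> (\<lambda>s. {v, s}) ` S"
  obtains T where "S \<union> insert v (set c) \<subseteq> T" "T \<subseteq> V"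
    "4 * card (induced_edges E S) + 7 * card T + 4 * card F + 3
        \<le> 4 * card (induced_edges E T) + 7 * card S + 4
     \<or> card T = card S + 4 \<and> card (induced_edges E S) + 6 + card F \<le> card (induced_edges E T)"
proof -
  define T where "T = S \<union> insert v (set c)"
  have l: "3 \<le> length c" and d: "distinct c"
    using W by (auto simp: is_wheel_def)
  have finV: "finite V" using G by (simp add: simple_graph_def)
  then have finS: "finite S" using S finite_subset by blast
  have TV: "T \<subseteq> V" using wheel_subset[OF G W] S by (simp add: T_def)
  then have finT: "finite T" using finV finite_subset by blast
  have vc: "v \<notin> set c" using wheel_hub_notin[OF G W] .
  have "set c - S = set c" using disj by auto
  then have m: "card (set c - S) = length c" using distinct_card[OF d] by simp
  have vS: "v \<notin> S" using disj by auto
  have nth: "c ! i \<in> set c" "c ! i \<noteq> v" "c ! i \<notin> S" if "i < length c" for i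
    using vc disj nth_mem[OF that] by blast+
  have rimc: "e \<inter> S = {} \<and> v \<notin> e" if e: "e \<in> rim c" for e
  proof -
    obtain i where i: "i < length c" "e = {c ! i, c ! (Suc i mod length c)}"
      using e by (auto simp: rim_def)
    have "Suc i mod length c < length c" using i by (intro mod_less_divisor) linarith
    then show ?thesis using i nth by auto
  qed
  have F_T: "F \<subseteq> induced_edges E T" using F by (auto simp: induced_edges_def T_def)
  have F_new: "F \<inter> (induced_edges E S \<union> rim c \<union> spokes v c) = {}"
  proof -
    have "F \<inter> induced_edges E S = {}" using F vS by (auto simp: induced_edges_def)
    moreover have "F \<inter> rim c = {}" using F rimc by blast
    moreover have "\<forall>s\<in>S. {v, s} \<notin> spokes v c"
      using disj by (auto simp: spokes_def doubleton_eq_iff)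
    then have "F \<inter> spokes v c = {}" using F by blast
    ultimately show ?thesis by blast
  qed
  have finF: "finite F" using F(2) finS finite_surj by blast
  have grow: "card (induced_edges E S) + card X + 2 * length c \<le> card (induced_edges E T)"
    if "X \<subseteq> induced_edges E T" "X \<inter> (induced_edges E S \<union> rim c \<union> spokes v c) = {}" for X
    using wheel_growth[OF G W, of X S] that m vS by (simp add: T_def)
  have cT: "card T = card S + length c + 1"
    using card_wheel_union[OF G W finS] m vS by (simp add: T_def)
  show thesis
  proof (cases "length c = 3")
    case True
    then show thesis using that[of T] TV grow[OF F_T F_new] cT by (simp add: T_def)
  next
    case False
    then have l4: "4 \<le> length c" using l by simp
    \<comment> \<open>inside the wheel alone, the neighbourhood of this rim vertex induces only a path\<close>
    let ?u = "c ! 1"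
    have u: "?u \<in> T" "?u \<notin> S" "?u \<noteq> v" using nth[of 1] l by (auto simp: T_def)
    obtain b where b: "is_wheel E ?u b" using locally_nonforesty_wheel[OF L] u TV by blast
    show thesis
    proof (cases "insert ?u (set b) \<subseteq> T")
      case False
      \<comment> \<open>The first wheel changes \<open>f\<close> by at least
        \<open>l - 7 + 4 * card F\<close>, where \<open>l \<ge> 4\<close>, and the second wheel,
        which meets \<open>T\<close> in its hub, adds at least 3 more.\<close>
      define T' where "T' = T \<union> insert ?u (set b)"
      have "4 * card (induced_edges E T) + 7 * card T' + 3
          \<le> 4 * card (induced_edges E T') + 7 * card T"
        using meeting_wheel_gain[OF G b finT _ False] u by (simp add: T'_def)
      moreover have "T' \<subseteq> V" using wheel_subset[OF G b] TV by (simp add: T'_def)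
      moreover have "S \<union> insert v (set c) \<subseteq> T'" by (auto simp: T'_def T_def)
      ultimately show thesis
        using that[of T'] grow[OF F_T F_new] cT l4 by linarith
    next
      case True
      have bl: "3 \<le> length b" and bd: "distinct b" and bE: "rim b \<subseteq> E"
        and bs: "spokes ?u b \<subseteq> E"
        using b by (auto simp: is_wheel_def)
      have idx: "c ! i = c ! j \<longleftrightarrow> i = j" if "i < length c" "j < length c" for i j
        using that d by (simp add: nth_eq_iff_index_eq)
      have pos: "0 < length c" "1 < length c" "2 < length c" using l4 by linarith+
      \<comment> \<open>The second wheel lies inside \<open>T\<close> and must supply an edge that
        is not yet counted: avoiding \<open>v\<close> excludes spokes and \<open>F\<close>, and
        \<open>x \<notin> S\<close> excludes the edges inside \<open>S\<close>.\<close>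
      have "\<exists>x y. {x, y} \<in> E \<and> {x, y} \<subseteq> T \<and> x \<notin> S \<and> x \<noteq> v \<and> y \<noteq> v \<and> {x, y} \<notin> rim c"
      proof (cases "set b \<subseteq> {v, c ! 0, c ! 2}")
        case True
        \<comment> \<open>Here the rim of \<open>b\<close> is the triangle on \<open>v\<close>,
          \<open>c ! 0\<close> and \<open>c ! 2\<close>, so the new edge is the chord joining
          \<open>c ! 0\<close> and \<open>c ! 2\<close>.\<close>
        have "card (set b) = length b" using bd by (rule distinct_card)
        moreover have "card {v, c ! 0, c ! 2} \<le> 3" by (simp add: card_insert_if)
        moreover have "card (set b) \<le> card {v, c ! 0, c ! 2}" using True by (intro card_mono) auto
        ultimately have "set b = {v, c ! 0, c ! 2}" and b3: "length b = 3"
          using True bl card_subset_eq[OF _ True] by auto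
        then have "c ! 0 \<in> set b" "c ! 2 \<in> set b" by auto
        then obtain i j where ij: "i < 3" "j < 3" "b ! i = c ! 0" "b ! j = c ! 2"
          using b3 by (auto simp: in_set_conv_nth)
        have "c ! 0 \<noteq> c ! 2" using idx[OF pos(1,3)] by simp
        then have "i \<noteq> j" using ij by auto
        moreover have "i = 0 \<or> i = 1 \<or> i = 2" "j = 0 \<or> j = 1 \<or> j = 2"
          using ij(1,2) by linarith+
        \<comment> \<open>On a triangle any two different positions are cyclically adjacent.\<close>
        ultimately have adj: "j = Suc i mod 3 \<or> i = Suc j mod 3" by (elim disjE) simp_all
        have edge: "{b ! k, b ! (Suc k mod 3)} \<in> E" if "k < 3" for k
          using bE that b3 by (auto simp: rim_def)
        have "{b ! i, b ! j} \<in> E"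
          using adj
        proof
          assume "j = Suc i mod 3"
          then show ?thesis using edge[OF ij(1)] by simp
        next
          assume "i = Suc j mod 3"
          then have "{b ! j, b ! i} \<in> E" using edge[OF ij(2)] by simp
          then show ?thesis by (simp only: insert_commute)
        qed
        then have "{c ! 0, c ! 2} \<in> E" unfolding ij(3,4) .
        \<comment> \<open>Positions 0 and 2 are adjacent only on a cycle of length 3.\<close>
        moreover have "{c ! 0, c ! 2} \<notin> rim c"
        proof
          assume "{c ! 0, c ! 2} \<in> rim c"
          then obtain i where i: "i < length c" "{c ! 0, c ! 2} = {c ! i, c ! (Suc i mod length c)}"
            by (auto simp: rim_def)
          have s: "Suc i mod length c < length c" using i by (intro mod_less_divisor) linarith
          have "0 = i \<and> 2 = Suc i mod length c \<or> 0 = Suc i mod length c \<and> 2 = i"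
            using i(2) unfolding doubleton_eq_iff idx[OF pos(1) i(1)] idx[OF pos(3) i(1)]
              idx[OF pos(1) s] idx[OF pos(3) s] .
          moreover have "Suc i mod length c = (if Suc i = length c then 0 else Suc i)"
            using i(1) by auto
          ultimately show False using l4 by (auto split: if_splits)
        qed
        ultimately show ?thesis
          using nth[OF pos(1)] nth[OF pos(3)]
          by (intro exI[of _ "c ! 0"] exI[of _ "c ! 2"]) (simp add: T_def)
      next
        case False
        \<comment> \<open>The new edge is now a spoke of \<open>b\<close>: the only neighbours of
          \<open>c ! 1\<close> along the rim of \<open>c\<close> are \<open>c ! 0\<close> and
          \<open>c ! 2\<close>.\<close>
        then obtain x where x: "x \<in> set b" "x \<noteq> v" "x \<noteq> c ! 0" "x \<noteq> c ! 2" by auto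
        have "{?u, x} \<notin> rim c"
        proof
          assume "{?u, x} \<in> rim c"
          then obtain i where i: "i < length c" "{?u, x} = {c ! i, c ! (Suc i mod length c)}"
            by (auto simp: rim_def)
          have s: "Suc i mod length c < length c" using i by (intro mod_less_divisor) linarith
          have "1 = i \<and> x = c ! (Suc i mod length c) \<or> 1 = Suc i mod length c \<and> x = c ! i"
            using i(2) unfolding doubleton_eq_iff idx[OF pos(2) i(1)] idx[OF pos(2) s] .
          moreover have "Suc i mod length c = (if Suc i = length c then 0 else Suc i)"
            using i(1) by auto
          ultimately have "x = c ! 2 \<or> x = c ! 0"
            using l4 by (auto simp: numeral_2_eq_2 split: if_splits)
          then show False using x by simp
        qed
        moreover have "{?u, x} \<in> E" using bs x by (auto simp: spokes_def)
        moreover have "{?u, x} \<subseteq> T" using True x by auto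
        ultimately show ?thesis using u x by blast
      qed
      then obtain x y where xy: "{x, y} \<in> E" "{x, y} \<subseteq> T" "x \<notin> S" "x \<noteq> v" "y \<noteq> v"
        "{x, y} \<notin> rim c" by blast
      have "{x, y} \<notin> F" using F xy by (auto simp: doubleton_eq_iff)
      then have card_X: "card (insert {x, y} F) = Suc (card F)" using finF by simp
      have X_T: "insert {x, y} F \<subseteq> induced_edges E T"
        using F_T xy by (auto simp: induced_edges_def)
      have "{x, y} \<notin> induced_edges E S \<union> rim c \<union> spokes v c"
        using xy by (auto simp: induced_edges_def spokes_def doubleton_eq_iff)
      then have X_new: "insert {x, y} F \<inter> (induced_edges E S \<union> rim c \<union> spokes v c) = {}"
        using F_new by blast
      have "card (induced_edges E S) + Suc (card F) + 2 * length c \<le> card (induced_edges E T)"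
        using grow[OF X_T X_new] unfolding card_X .
      then show thesis using that[of T] TV cT l4 by (simp add: T_def)
    qed
  qed
qed

section \<open>The lower bound on the size\<close>

text \<open>Without such an edge, a walk starting in \<open>S\<close> would never leave
  \<open>S\<close>. The vertex \<open>v\<close> becomes the hub of the next wheel.\<close>

lemma connected_boundary_edge:
  assumes G: "simple_graph V E" and C: "connected_graph V E"
    and S: "S \<subseteq> V" "S \<noteq> {}" "S \<noteq> V"
  obtains v s where "v \<in> V - S" "s \<in> S" "{v, s} \<in> E"
proof -
  obtain s t where st: "s \<in> S" "t \<in> V - S" using S by blast
  have "(s, t) \<in> {(x, y). {x, y} \<in> E}\<^sup>*"
    using C st S unfolding connected_graph_def by auto
  moreover have "t \<in> S" if no: "\<forall>v \<in> V - S. \<forall>s \<in> S. {v, s} \<notin> E"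
    using calculation
  proof induction
    case base
    then show ?case using st by simp
  next
    case (step y z)
    then have "{z, y} \<in> E" by (simp add: insert_commute)
    then show ?case using edge_in_graph[OF G] step(3) no by blast
  qed
  ultimately show ?thesis using st that by blast
qed

lemma size_lower_bound:
  assumes G: "simple_graph V E" and C: "connected_graph V E" and L: "locally_nonforesty V E"
  shows "7 * card V \<le> 4 * card E + 1 \<or> 4 dvd card V \<and> 7 * card V \<le> 4 * card E + 4"
proof -
  \<comment> \<open>In terms of \<open>f\<close>: either \<open>f(S) \<ge> 3\<close>, or
    \<open>f(S) \<ge> 0\<close> and 4 divides \<open>card S\<close>. A gain of 3 leads to the first
    case; a copy of \<open>K\<^sub>4\<close> with its connecting edge does not decrease
    \<open>f\<close> and preserves divisibility.\<close>
  define good where "good S \<longleftrightarrow> 7 * card S \<le> 4 * card (induced_edges E S) + 1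
    \<or> 4 dvd card S \<and> 7 * card S \<le> 4 * card (induced_edges E S) + 4" for S
  have finV: "finite V" using G by (simp add: simple_graph_def)
  have start: "\<exists>T. T \<subseteq> V \<and> T \<noteq> {} \<and> good T"
  proof -
    obtain v where v: "v \<in> V" using C by (auto simp: connected_graph_def)
    then obtain c where c: "is_wheel E v c" using locally_nonforesty_wheel[OF L] by blast
    \<comment> \<open>the missing connecting edge is the reason for the constant 4 in the bound\<close>
    obtain T where T: "{} \<union> insert v (set c) \<subseteq> T" "T \<subseteq> V"
      "4 * card (induced_edges E {}) + 7 * card T + 4 * card ({} :: 'a set set) + 3
        \<le> 4 * card (induced_edges E T) + 7 * card ({} :: 'a set) + 4
     \<or> card T = card ({} :: 'a set) + 4
        \<and> card (induced_edges E {}) + 6 + card ({} :: 'a set set) \<le> card (induced_edges E T)"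
      using disjoint_wheel_gain[OF G L c, of "{}" "{}"] by auto
    then show ?thesis by (intro exI[of _ T]) (auto simp: good_def)
  qed
  have step: "\<exists>T. S \<subset> T \<and> T \<subseteq> V \<and> good T" if S: "S \<subseteq> V" "S \<noteq> {}" "S \<noteq> V" "good S" for S
  proof -
    have finS: "finite S" using S finV finite_subset by blast
    obtain v s where vs: "v \<in> V - S" "s \<in> S" "{v, s} \<in> E"
      using connected_boundary_edge[OF G C S(1-3)] .
    then obtain c where c: "is_wheel E v c" using locally_nonforesty_wheel[OF L] by blast
    show ?thesis
    proof (cases "set c \<inter> S = {}")
      case True
      obtain T where T: "S \<union> insert v (set c) \<subseteq> T" "T \<subseteq> V"
        "4 * card (induced_edges E S) + 7 * card T + 4 * card {{v, s}} + 3
        \<le> 4 * card (induced_edges E T) + 7 * card S + 4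
     \<or> card T = card S + 4 \<and> card (induced_edges E S) + 6 + card {{v, s}}
          \<le> card (induced_edges E T)"
        using disjoint_wheel_gain[OF G L c S(1), of "{{v, s}}"] True vs by auto
      then have "good T" using S(4) by (auto simp: good_def)
      then show ?thesis using T vs by blast
    next
      case False
      let ?T = "S \<union> insert v (set c)"
      have "4 * card (induced_edges E S) + 7 * card ?T + 3
          \<le> 4 * card (induced_edges E ?T) + 7 * card S"
        using meeting_wheel_gain[OF G c finS] False vs by auto
      then have "good ?T" using S(4) by (auto simp: good_def)
      moreover have "S \<subset> ?T" using vs(1) by auto
      moreover have "?T \<subseteq> V" using S(1) wheel_subset[OF G c] by (rule Un_least)
      ultimately show ?thesis by (intro exI conjI)
    qed
  qed
  \<comment> \<open>An inclusion-maximal good set replaces the iterated growth: by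
    \<open>step\<close> it can only be \<open>V\<close>.\<close>
  let ?P = "{T. T \<subseteq> V \<and> T \<noteq> {} \<and> good T}"
  have "finite ?P" by (rule finite_subset[of _ "Pow V"]) (use finV in auto)
  moreover have "?P \<noteq> {}" using start by auto
  ultimately have "\<exists>T\<in>?P. \<forall>U\<in>?P. T \<subseteq> U \<longrightarrow> T = U"
    by (rule finite_has_maximal)
  then obtain T where T: "T \<in> ?P" and max: "\<forall>U\<in>?P. T \<subseteq> U \<longrightarrow> T = U" by (rule bexE)
  have "T = V"
  proof (rule ccontr)
    assume "T \<noteq> V"
    then obtain U where U: "T \<subset> U" "U \<subseteq> V" "good U" using step[of T] T by auto
    then have "U \<in> ?P" by auto
    then have "T \<subseteq> U \<longrightarrow> T = U" by (rule bspec[OF max])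
    then show False using U(1) by auto
  qed
  moreover have "induced_edges E V = E"
    using G by (auto simp: induced_edges_def simple_graph_def)
  ultimately show ?thesis using T by (simp add: good_def)
qed

section \<open>Cliques and unions of graphs\<close>

definition clique_edges :: "'a set \<Rightarrow> 'a set set" where
  "clique_edges A = {e. e \<subseteq> A \<and> card e = 2}"

text \<open>Fixing the vertices as \<open>{..<n}\<close> lets a new block take the next free
  numbers, with \<open>n - 1\<close> as the point of attachment.\<close>

definition realizable :: "nat \<Rightarrow> nat \<Rightarrow> bool" where
  "realizable n m \<longleftrightarrow> (\<exists>E. simple_graph {..<n} E \<and> connected_graph {..<n} E \<and>
     locally_nonforesty {..<n} E \<and> card E = m)"

lemma card_clique_edges:
  "finite A \<Longrightarrow> card (clique_edges A) = card A choose 2"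
  unfolding clique_edges_def by (rule n_subsets)

lemma simple_clique: "finite A \<Longrightarrow> simple_graph A (clique_edges A)"
  by (auto simp: simple_graph_def clique_edges_def)

lemma simple_graph_Un:
  "simple_graph V E \<Longrightarrow> simple_graph W F \<Longrightarrow> simple_graph (V \<union> W) (E \<union> F)"
  by (auto simp: simple_graph_def)

lemma connected_clique:
  assumes "A \<noteq> {}"
  shows "connected_graph A (clique_edges A)"
proof -
  have "(u, v) \<in> {(x, y). {x, y} \<in> clique_edges A}\<^sup>*" if "u \<in> A" "v \<in> A" for u v
    using that by (cases "u = v") (auto simp: clique_edges_def intro!: r_into_rtrancl)
  then show ?thesis using assms by (simp add: connected_graph_def)
qed

lemma connected_graph_Un:
  assumes "connected_graph V E" and "connected_graph W F" and "V \<inter> W \<noteq> {}"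
  shows "connected_graph (V \<union> W) (E \<union> F)"
proof -
  obtain w where w: "w \<in> V" "w \<in> W" using assms(3) by auto
  let ?R = "\<lambda>E. {(x, y). {x, y} \<in> E}\<^sup>*"
  have mono: "?R E \<subseteq> ?R (E \<union> F)" "?R F \<subseteq> ?R (E \<union> F)" by (auto intro!: rtrancl_mono)
  have "(x, w) \<in> ?R (E \<union> F) \<and> (w, x) \<in> ?R (E \<union> F)" if "x \<in> V \<union> W" for x
    using that w assms(1,2) mono unfolding connected_graph_def by blast
  then show ?thesis
    using w unfolding connected_graph_def by (blast intro: rtrancl_trans)
qed

lemma contains_cycle_mono:
  "contains_cycle V E \<Longrightarrow> V \<subseteq> W \<Longrightarrow> E \<subseteq> F \<Longrightarrow> contains_cycle W F"
  unfolding contains_cycle_def is_cycle_def by blast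

text \<open>Adding edges only enlarges neighbourhoods and local subgraphs, so cycles survive. The
  set \<open>G\<close> may exceed \<open>E \<union> F\<close>, which makes room for a
  bridge.\<close>

lemma locally_nonforesty_Un:
  assumes "locally_nonforesty V E" and "locally_nonforesty W F" and "E \<union> F \<subseteq> G"
  shows "locally_nonforesty (V \<union> W) G"
proof -
  have "contains_cycle (neighborhood G v) (induced_edges G (neighborhood G v))"
    if "contains_cycle (neighborhood H v) (induced_edges H (neighborhood H v))" "H \<subseteq> G" for H v
    using that(2) by (intro contains_cycle_mono[OF that(1)])
      (auto simp: neighborhood_def induced_edges_def)
  then show ?thesis using assms unfolding locally_nonforesty_def by blast
qed

lemma locally_nonforesty_K4:
  assumes "card A = 4"
  shows "locally_nonforesty A (clique_edges A)"
  unfolding locally_nonforesty_def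
proof
  fix v assume v: "v \<in> A"
  then have "card (A - {v}) = 3" using assms by simp
  then obtain x y z where xyz: "A - {v} = {x, y, z}" "x \<noteq> y" "y \<noteq> z" "x \<noteq> z"
    by (auto simp: card_3_iff)
  then have mem: "x \<in> A" "y \<in> A" "z \<in> A" "x \<noteq> v" "y \<noteq> v" "z \<noteq> v" by blast+
  let ?N = "neighborhood (clique_edges A) v"
  have N: "?N = {x, y, z}"
  proof -
    have "?N = A - {v}"
    proof (intro equalityI subsetI)
      fix u assume "u \<in> ?N"
      then have "u \<in> A" "card {v, u} = 2" by (auto simp: neighborhood_def clique_edges_def)
      then show "u \<in> A - {v}" by (cases "u = v") auto
    next
      fix u assume "u \<in> A - {v}"
      then show "u \<in> ?N" using v by (auto simp: neighborhood_def clique_edges_def)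
    qed
    then show ?thesis using xyz(1) by simp
  qed
  have "{x, y} \<in> induced_edges (clique_edges A) ?N" "{y, z} \<in> induced_edges (clique_edges A) ?N"
    "{z, x} \<in> induced_edges (clique_edges A) ?N"
    unfolding N using mem xyz(2-4) by (simp_all add: induced_edges_def clique_edges_def)
  then have "{[x, y, z] ! i, [x, y, z] ! (Suc i mod 3)} \<in> induced_edges (clique_edges A) ?N"
    if "i < 3" for i
  proof -
    consider "i = 0" | "i = 1" | "i = 2" using \<open>i < 3\<close> by linarith
    then show ?thesis by cases (use \<open>{x, y} \<in> _\<close> \<open>{y, z} \<in> _\<close> \<open>{z, x} \<in> _\<close> in simp_all)
  qed
  then have "is_cycle ?N (induced_edges (clique_edges A) ?N) [x, y, z]"
    using xyz(2-4) unfolding is_cycle_def N by simp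
  then show "contains_cycle ?N (induced_edges (clique_edges A) ?N)"
    by (auto simp: contains_cycle_def)
qed

section \<open>The extremal graphs\<close>

lemma realizable_4: "realizable 4 6"
  unfolding realizable_def
  by (rule exI[of _ "clique_edges {..<4}"])
    (simp add: simple_clique connected_clique locally_nonforesty_K4 card_clique_edges
      choose_two lessThan_empty_iff)

lemma realizable_5: "realizable 5 9"
proof -
  let ?A = "{..<4::nat}" and ?B = "{1..<5::nat}"
  let ?E = "clique_edges ?A \<union> clique_edges ?B"
  have V: "{..<5} = ?A \<union> ?B" by auto
  have "clique_edges ?A \<inter> clique_edges ?B = clique_edges (?A \<inter> ?B)"
    by (auto simp: clique_edges_def)
  also have "?A \<inter> ?B = {1..<4}" by auto
  finally have "clique_edges ?A \<inter> clique_edges ?B = clique_edges {1..<4}" .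
  moreover have "finite (clique_edges ?A)" "finite (clique_edges ?B)"
    by (auto simp: clique_edges_def)
  \<comment> \<open>Two copies of \<open>K\<^sub>4\<close> have 6 edges each, and the 3 edges of the
    common triangle are counted twice.\<close>
  ultimately have "card ?E + 3 = 12"
    using card_Un_Int[of "clique_edges ?A" "clique_edges ?B"]
    by (simp add: card_clique_edges choose_two)
  moreover have "simple_graph {..<5} ?E"
    unfolding V by (intro simple_graph_Un simple_clique) auto
  moreover have "connected_graph {..<5} ?E"
    unfolding V
  proof (intro connected_graph_Un connected_clique)
    have "1 \<in> ?A" "1 \<in> ?B" by auto
    then show "?A \<noteq> {}" "?B \<noteq> {}" "?A \<inter> ?B \<noteq> {}" by blast+
  qed
  moreover have "locally_nonforesty {..<5} ?E"
    unfolding V by (rule locally_nonforesty_Un[OF locally_nonforesty_K4 locally_nonforesty_K4]) auto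
  ultimately show ?thesis by (auto simp: realizable_def)
qed

text \<open>The new \<open>K\<^sub>4\<close> shares only the vertex \<open>n - 1\<close> with the
  old graph, hence no edge.\<close>

lemma realizable_glue_K4:
  assumes "realizable n m" and "0 < n"
  shows "realizable (n + 3) (m + 6)"
proof -
  obtain E where E: "simple_graph {..<n} E" "connected_graph {..<n} E"
    "locally_nonforesty {..<n} E" "card E = m"
    using assms(1) by (auto simp: realizable_def)
  let ?A = "{n - 1..<n + 3}"
  let ?E = "E \<union> clique_edges ?A"
  have V: "{..<n + 3} = {..<n} \<union> ?A" using assms(2) by auto
  have "E \<inter> clique_edges ?A = {}"
  proof (rule ccontr)
    assume "E \<inter> clique_edges ?A \<noteq> {}"
    then obtain e where "e \<subseteq> {..<n}" "e \<subseteq> ?A" "card e = 2"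
      using E(1) by (auto simp: simple_graph_def clique_edges_def)
    moreover from this have "e \<subseteq> {n - 1}" by fastforce
    ultimately show False using card_mono[of "{n - 1}" e] by simp
  qed
  then have "card ?E = m + 6"
    using E(4) finite_edges[OF E(1)] card_Un_disjoint[of E "clique_edges ?A"] assms(2)
    by (simp add: card_clique_edges choose_two
        finite_edges[OF simple_clique])
  moreover have "simple_graph {..<n + 3} ?E"
    unfolding V by (intro simple_graph_Un simple_clique E) auto
  moreover have "connected_graph {..<n + 3} ?E"
    unfolding V using assms(2)
    by (intro connected_graph_Un connected_clique E)
      (auto simp: disjoint_iff intro!: exI[of _ "n - 1"])
  moreover have "locally_nonforesty {..<n + 3} ?E"
    unfolding V by (rule locally_nonforesty_Un[OF E(3) locally_nonforesty_K4]) (use assms(2) in auto)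
  ultimately show ?thesis by (auto simp: realizable_def)
qed

lemma realizable_bridge_K4:
  assumes "realizable n m" and "0 < n"
  shows "realizable (n + 4) (m + 7)"
proof -
  obtain E where E: "simple_graph {..<n} E" "connected_graph {..<n} E"
    "locally_nonforesty {..<n} E" "card E = m"
    using assms(1) by (auto simp: realizable_def)
  \<comment> \<open>The bridge is treated as a clique on two vertices, so that the results on unions
    apply to it.\<close>
  let ?A = "{n..<n + 4}" and ?B = "{n - 1, n}"
  let ?E = "E \<union> clique_edges ?B \<union> clique_edges ?A"
  have V: "{..<n + 4} = {..<n} \<union> ?B \<union> ?A" using assms(2) by auto
  \<comment> \<open>This decomposition omits the bridge, which is not locally nonforesty by
    itself.\<close>
  have V': "{..<n + 4} = {..<n} \<union> ?A" by auto
  have fin: "finite E" "finite (clique_edges ?A)" "finite (clique_edges ?B)"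
    using finite_edges[OF E(1)] by (auto intro: finite_edges[OF simple_clique])
  have eB: "clique_edges ?B = {?B}"
  proof -
    have "e = ?B" if "e \<in> clique_edges ?B" for e
      using that assms(2) by (intro card_subset_eq) (auto simp: clique_edges_def)
    moreover have "?B \<in> clique_edges ?B" using assms(2) by (simp add: clique_edges_def)
    ultimately show ?thesis by blast
  qed
  have "\<not> ?B \<subseteq> {..<n}" "\<not> ?B \<subseteq> ?A" using assms(2) by auto
  then have "E \<inter> clique_edges ?B = {}" "clique_edges ?B \<inter> clique_edges ?A = {}"
    unfolding eB using E(1) by (auto simp: simple_graph_def clique_edges_def)
  moreover have "E \<inter> clique_edges ?A = {}"
  proof (rule ccontr)
    assume "E \<inter> clique_edges ?A \<noteq> {}"
    then obtain e where "e \<subseteq> {..<n}" "e \<subseteq> ?A" "card e = 2"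
      using E(1) by (auto simp: simple_graph_def clique_edges_def)
    moreover from this have "e = {}" by fastforce
    ultimately show False by simp
  qed
  ultimately have "card ?E = card E + card (clique_edges ?B) + card (clique_edges ?A)"
    using fin by (subst card_Un_disjoint) (auto simp: card_Un_disjoint)
  then have "card ?E = m + 7"
    using E(4) by (simp only: eB) (simp add: card_clique_edges choose_two)
  moreover have "simple_graph {..<n + 4} ?E"
    unfolding V by (intro simple_graph_Un simple_clique E) auto
  moreover have "connected_graph {..<n + 4} ?E"
    unfolding V using assms(2)
    by (intro connected_graph_Un connected_clique E) auto
  moreover have "locally_nonforesty {..<n + 4} ?E"
    unfolding V' by (rule locally_nonforesty_Un[OF E(3) locally_nonforesty_K4]) auto
  ultimately show ?thesis by (auto simp: realizable_def)
qed

text \<open>Bridging a \<open>K\<^sub>4\<close> adds 4 vertices and 7 edges, matching the growth of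
  \<open>p\<close>. The base orders 4, 5, 10 and 7 represent the residues 0, 1, 2 and 3; as 6 is
  excluded, residue 2 starts at 10.\<close>

lemma realizable_p:
  assumes "4 \<le> n" and "n \<noteq> 6"
  shows "realizable n (p n)"
  using assms
proof (induction n rule: less_induct)
  case (less n)
  have seven: "realizable 7 12" using realizable_glue_K4[OF realizable_4] by simp
  have ten: "realizable 10 18" using realizable_glue_K4[OF seven] by simp
  show ?case
  proof (cases "n \<in> {4, 5, 7, 10}")
    case True
    then show ?thesis using realizable_4 realizable_5 seven ten by (auto simp: p_def)
  next
    case False
    then have n: "8 \<le> n" "n - 4 \<noteq> 6" using less.prems by auto
    then have "realizable (n - 4 + 4) (p (n - 4) + 7)"
      using less by (intro realizable_bridge_K4) auto
    \<comment> \<open>Writing \<open>n = k + 4\<close> avoids truncated subtraction. The residue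
      modulo 4 is kept and the quotient rises by 1, so \<open>p\<close> grows by 8 - 1.\<close>
    moreover obtain k where k: "n = k + 4" "4 \<le> k" using n by (intro that[of "n - 4"]) auto
    have "p n = p (n - 4) + 7" unfolding k(1) using k(2) by (auto simp: p_def)
    ultimately show ?thesis using n by simp
  qed
qed

theorem theorem4:
  fixes n :: nat
  assumes "n \<ge> 8"
  shows "(\<forall>(V :: 'a set) E. simple_graph V E \<and> connected_graph V E \<and>
            locally_nonforesty V E \<and> card V = n \<longrightarrow> p n \<le> card E)
       \<and> (\<exists>(V :: nat set) E. simple_graph V E \<and> connected_graph V E \<and>
            locally_nonforesty V E \<and> card V = n \<and> card E = p n)"
proof (intro conjI allI impI)
  fix V :: "'a set" and E
  assume "simple_graph V E \<and> connected_graph V E \<and> locally_nonforesty V E \<and> card V = n"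
  then have "7 * n \<le> 4 * card E + 1 \<or> n mod 4 = 0 \<and> 7 * n \<le> 4 * card E + 4"
    using size_lower_bound[of V E] by (auto simp: dvd_eq_mod_eq_0)
  \<comment> \<open>With \<open>n = 4 * q + r\<close> the bound says
    \<open>4 * card E \<ge> 28 * q + 7 * r - 1\<close>, or
    \<open>4 * card E \<ge> 28 * q - 4\<close> if \<open>r = 0\<close>. Rounding up to an integer
    gives at least \<open>7 * q - 1\<close>, \<open>7 * q + 2\<close>, \<open>7 * q + 4\<close> and
    \<open>7 * q + 5\<close> for \<open>r\<close> = 0, 1, 2, 3, the values of
    \<open>p n\<close>.\<close>
  moreover have "n = 4 * (n div 4) + n mod 4" "n mod 4 < 4" by simp_all
  ultimately show "p n \<le> card E" unfolding p_def by (split if_split) linarith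
next
  have "realizable n (p n)" using assms by (intro realizable_p) auto
  then obtain E where "simple_graph {..<n} E" "connected_graph {..<n} E"
    "locally_nonforesty {..<n} E" "card E = p n"
    unfolding realizable_def by blast
  then show "\<exists>(V :: nat set) E. simple_graph V E \<and> connected_graph V E \<and>
      locally_nonforesty V E \<and> card V = n \<and> card E = p n"
    by (intro exI[of _ "{..<n}"] exI[of _ E]) simp
qed

end
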